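(* Let $X$ be a real-valued random variable on a probability space $(\Omega,\mathcal{F},\mathbb{P})$, and suppose $X\le M$ for a real number $M$. Then for any $n\ge 1$ and any real numbers $0<\lambda_1<\lambda_2<\cdots<\lambda_n<M$, $$\sum_{k=1}^{n}(\lambda_{k+1}-\lambda_k)\,\mathbb{P}(X\le\lambda_k)\le M-\mathbb{E}(X),$$ where $\lambda_{n+1}=M$.
   Context: $\mathbb{E}(X)$ denotes the expectation of $X$; since $X\le M$, it is well defined in $[-\infty,M]$, and if $\mathbb{E}(X)=-\infty$ the right-hand side is $+\infty$. *)

theory Defs
  imports "HOL-Probability.Probability"
begin

text \<open>
  Extended-real expectation \<open>E(X\<^sup>+) - E(X\<^sup>-)\<close>. Since \<open>ennreal\<close> sends negative reals to \<open>0\<close>,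
  \<open>ennreal (X \<omega>)\<close> and \<open>ennreal (- X \<omega>)\<close> are the positive and the negative part of \<open>X\<close>. The library
  expectation cannot be used here, because it is \<open>0\<close> for a non-integrable \<open>X\<close>. In the meaningless
  case \<open>E(X\<^sup>+) = E(X\<^sup>-) = \<infinity>\<close>, which cannot occur when \<open>X\<close> is bounded above, the value is \<open>\<infinity>\<close>.
\<close>

definition ereal_expectation :: "'a measure \<Rightarrow> ('a \<Rightarrow> real) \<Rightarrow> ereal" where
  "ereal_expectation P X =
     enn2ereal (\<integral>\<^sup>+\<omega>. ennreal (X \<omega>) \<partial>P) - enn2ereal (\<integral>\<^sup>+\<omega>. ennreal (- X \<omega>) \<partial>P)"

lemma ereal_expectation_integrable:
  assumes "integrable P X"
  shows "ereal_expectation P X = ereal (integral\<^sup>L P X)"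
proof -
  have 1: "(\<integral>\<^sup>+\<omega>. ennreal (X \<omega>) \<partial>P) \<noteq> \<infinity>" "(\<integral>\<^sup>+\<omega>. ennreal (- X \<omega>) \<partial>P) \<noteq> \<infinity>"
    using assms by (auto simp: real_integrable_def)
  then obtain a b where "0 \<le> a" "(\<integral>\<^sup>+\<omega>. ennreal (X \<omega>) \<partial>P) = ennreal a"
      "0 \<le> b" "(\<integral>\<^sup>+\<omega>. ennreal (- X \<omega>) \<partial>P) = ennreal b"
    by (metis ennreal_cases infinity_ennreal_def)
  then show ?thesis
    by (simp add: ereal_expectation_def real_lebesgue_integral_def[OF assms] enn2ereal_ennreal)
qed

lemma ereal_expectation_not_integrable:
  assumes "prob_space P" "X \<in> borel_measurable P" "AE \<omega> in P. X \<omega> \<le> M" "\<not> integrable P X"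
  shows "ereal_expectation P X = - \<infinity>"
proof -
  interpret prob_space P by fact
  have "(\<integral>\<^sup>+\<omega>. ennreal (X \<omega>) \<partial>P) \<le> (\<integral>\<^sup>+\<omega>. ennreal M \<partial>P)"
    using assms(3) by (intro nn_integral_mono_AE) (auto simp: ennreal_leI)
  also have "\<dots> = ennreal M"
    by (simp add: emeasure_space_1)
  finally have le: "(\<integral>\<^sup>+\<omega>. ennreal (X \<omega>) \<partial>P) \<le> ennreal M" .
  then have fin: "(\<integral>\<^sup>+\<omega>. ennreal (X \<omega>) \<partial>P) \<noteq> \<infinity>"
    by (metis ennreal_neq_top infinity_ennreal_def top.extremum_uniqueI)
  then have "(\<integral>\<^sup>+\<omega>. ennreal (- X \<omega>) \<partial>P) = \<infinity>"
    using assms by (auto simp: real_integrable_def)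
  moreover obtain a where "0 \<le> a" "(\<integral>\<^sup>+\<omega>. ennreal (X \<omega>) \<partial>P) = ennreal a"
    using fin by (metis ennreal_cases infinity_ennreal_def)
  ultimately show ?thesis
    by (simp add: ereal_expectation_def enn2ereal_ennreal)
qed

end

theory Submission
  imports Defs
begin

text \<open>
  For a real \<open>x\<close>, the sum of the gaps \<open>lam (k + 1) - lam k\<close> over those \<open>k\<close> with \<open>x \<le> lam k\<close>
  telescopes to \<open>lam (n + 1) - lam j\<close>, where \<open>j\<close> is the first index with \<open>x \<le> lam j\<close>. It is
  therefore at most \<open>lam (n + 1) - x = M - x\<close> whenever \<open>x \<le> M\<close>: this is
  \<open>sum_gaps_above_le\<close>. Putting \<open>x = X \<omega>\<close> bounds a step function of \<open>X\<close> by \<open>M - X\<close>, and taking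
  expectations turns each indicator of \<open>X \<le> lam k\<close> into a probability, which is the claim for
  integrable \<open>X\<close> (\<open>sum_gaps_prob_le\<close>). If \<open>X\<close> is not integrable, its expectation is \<open>-\<infinity>\<close> and
  the right-hand side is \<open>\<infinity>\<close>.
\<close>

text \<open>
  The truncation \<open>max 0\<close> makes the bound inductive: in the step from \<open>n\<close> to \<open>n + 1\<close>, the point
  \<open>x\<close> may lie above \<open>lam (n + 1)\<close>, and then all the gaps counted so far must contribute nothing.
\<close>

lemma sum_gaps_above_le:
  fixes lam :: "nat \<Rightarrow> real"
  assumes "\<And>k. 1 \<le> k \<Longrightarrow> k \<le> n \<Longrightarrow> lam k \<le> lam (k + 1)"
  shows "(\<Sum>k=1..n. (lam (k + 1) - lam k) * indicator {..lam k} x) \<le> max 0 (lam (n + 1) - x)"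
  using assms
proof (induction n)
  case 0
  show ?case by simp
next
  case (Suc n)
  have "(\<Sum>k=1..n. (lam (k + 1) - lam k) * indicator {..lam k} x) \<le> max 0 (lam (n + 1) - x)"
    by (rule Suc.IH, rule Suc.prems) auto
  moreover have "lam (Suc n) \<le> lam (Suc n + 1)"
    by (rule Suc.prems) auto
  ultimately show ?case
    by (auto simp: max_def indicator_def split: if_splits)
qed

lemma (in prob_space) sum_gaps_prob_le:
  fixes X :: "'a \<Rightarrow> real" and lam :: "nat \<Rightarrow> real"
  assumes X: "integrable M X"
    and bound: "AE \<omega> in M. X \<omega> \<le> lam (n + 1)"
    and mono: "\<And>k. 1 \<le> k \<Longrightarrow> k \<le> n \<Longrightarrow> lam k \<le> lam (k + 1)"
  shows "(\<Sum>k=1..n. (lam (k + 1) - lam k) * prob {\<omega> \<in> space M. X \<omega> \<le> lam k})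
           \<le> lam (n + 1) - expectation X"
proof -
  define A where "A k = {\<omega> \<in> space M. X \<omega> \<le> lam k}" for k
  have [measurable]: "X \<in> borel_measurable M"
    using X by simp
  have A [measurable]: "A k \<in> sets M" for k
    unfolding A_def by measurable
  have int: "integrable M (\<lambda>\<omega>. (lam (k + 1) - lam k) * indicator (A k) \<omega>)" for k
    by (intro integrable_mult_right integrable_real_indicator A) (simp add: emeasure_eq_measure)
  have "(\<Sum>k=1..n. (lam (k + 1) - lam k) * prob (A k))
      = expectation (\<lambda>\<omega>. \<Sum>k=1..n. (lam (k + 1) - lam k) * indicator (A k) \<omega>)"
    using int by (subst Bochner_Integration.integral_sum) simp_all
  also have "\<dots> \<le> expectation (\<lambda>\<omega>. lam (n + 1) - X \<omega>)"
  proof (rule integral_mono_AE)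
    show "AE \<omega> in M. (\<Sum>k=1..n. (lam (k + 1) - lam k) * indicator (A k) \<omega>) \<le> lam (n + 1) - X \<omega>"
      using bound AE_space
    proof eventually_elim
      case (elim \<omega>)
      have "(\<Sum>k=1..n. (lam (k + 1) - lam k) * indicator (A k) \<omega>)
          = (\<Sum>k=1..n. (lam (k + 1) - lam k) * indicator {..lam k} (X \<omega>))"
        using elim by (simp add: A_def indicator_def)
      also have "\<dots> \<le> max 0 (lam (n + 1) - X \<omega>)"
        by (rule sum_gaps_above_le) (rule mono)
      finally show ?case
        using elim by simp
    qed
  next
    show "integrable M (\<lambda>\<omega>. \<Sum>k=1..n. (lam (k + 1) - lam k) * indicator (A k) \<omega>)"
      by (rule Bochner_Integration.integrable_sum) (rule int)
  qed (use X in simp)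
  also have "\<dots> = lam (n + 1) - expectation X"
    using X by (simp add: prob_space)
  finally show ?thesis
    unfolding A_def .
qed

theorem corollary3p3:
  fixes P :: "'a measure" and X :: "'a \<Rightarrow> real" and M :: real
    and n :: nat and lam :: "nat \<Rightarrow> real"
  assumes "prob_space P"
    and "X \<in> borel_measurable P"
    and "AE \<omega> in P. X \<omega> \<le> M"
    and "n \<ge> 1"
    and "0 < lam 1"
    and "\<And>k. 1 \<le> k \<Longrightarrow> k < n \<Longrightarrow> lam k < lam (k + 1)"
    and "lam n < M"
    and "lam (n + 1) = M"
  shows "ereal (\<Sum>k=1..n. (lam (k + 1) - lam k) * measure P {\<omega> \<in> space P. X \<omega> \<le> lam k})
           \<le> ereal M - ereal_expectation P X"
proof (cases "integrable P X")
  case True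
  have mono: "lam k \<le> lam (k + 1)" if "1 \<le> k" "k \<le> n" for k
    using assms(6)[of k] assms(7,8) that by (cases "k = n") auto
  have "(\<Sum>k=1..n. (lam (k + 1) - lam k) * measure P {\<omega> \<in> space P. X \<omega> \<le> lam k})
      \<le> lam (n + 1) - integral\<^sup>L P X"
    using assms(3,8) by (intro prob_space.sum_gaps_prob_le[OF assms(1) True] mono) simp_all
  then show ?thesis
    using assms(8) by (simp add: ereal_expectation_integrable[OF True])
next
  case False
  then show ?thesis
    using ereal_expectation_not_integrable[OF assms(1-3)] by simp
qed

end
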